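(* For every fixed integer $s\ge 2$: (i) for every integer $n>s$, $f(n,n-s,n-2)=\binom{n}{2}-\mathrm{ex}(n,\{K_{s+1},K_{2s}-sK_2\})$; (ii) $f(n,n-s,n-2)= \frac{1}{2s-2}\, n^2 + o(n^2)$ as $n\to\infty$.
   Context: A $k$-partition of a finite set $X$ is a partition $\mathcal{P}=(X_1,\dots,X_k)$ of $X$ into precisely $k$ nonempty classes. An $r$-element set $H\subseteq X$ crosses $\mathcal{P}$ if $H$ intersects exactly $\min(r,k)$ of the classes. A hypergraph (set of subsets of $X$) crosses $\mathcal{P}$ if at least one of its members does. For integers $n\ge k$, $n\ge r$, $f(n,k,r)$ denotes the minimum number of edges of an $r$-uniform hypergraph $\mathcal{H}\subseteq\binom{X}{r}$ on an $n$-element set $X$ that crosses every $k$-partition of $X$. For a family $\mathfrak{F}$ of graphs, $\mathrm{ex}(n,\mathfrak{F})$ is the Turán number: the maximum number of edges in a simple graph on $n$ vertices containing no (not necessarily induced) subgraph isomorphic to any member of $\mathfrak{F}$. $K_m$ is the complete graph on $m$ vertices, and $K_{2s}-sK_2$ is the complete graph on $2s$ vertices minus a perfect matching. *)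

theory Defs
  imports Complex_Main "HOL-Library.Disjoint_Sets" "HOL-Library.Ramsey" "HOL-Library.Landau_Symbols"
begin

definition k_partition :: "nat \<Rightarrow> 'a set \<Rightarrow> 'a set set \<Rightarrow> bool" where
  "k_partition k X P \<longleftrightarrow> partition_on X P \<and> finite P \<and> card P = k"

definition set_crosses :: "'a set \<Rightarrow> 'a set set \<Rightarrow> bool" where
  "set_crosses H P \<longleftrightarrow> card {C \<in> P. H \<inter> C \<noteq> {}} = min (card H) (card P)"

definition hypergraph_crosses :: "'a set set \<Rightarrow> 'a set set \<Rightarrow> bool" where
  "hypergraph_crosses \<H> P \<longleftrightarrow> (\<exists>H\<in>\<H>. set_crosses H P)"

text \<open>The \<open>n\<close>-element ground set is taken to be \<open>{..<n}\<close>. The set under \<open>Min\<close> is finite, and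
  it is nonempty for \<open>n \<ge> k\<close> and \<open>n \<ge> r\<close>, because then the complete \<open>r\<close>-uniform hypergraph
  crosses every \<open>k\<close>-partition.\<close>

definition crossing_number :: "nat \<Rightarrow> nat \<Rightarrow> nat \<Rightarrow> nat" where
  "crossing_number n k r =
     Min (card ` {\<H>. \<H> \<subseteq> nsets {..<n} r \<and> (\<forall>P. k_partition k {..<n} P \<longrightarrow> hypergraph_crosses \<H> P)})"

type_synonym 'a graph = "'a set \<times> 'a set set"

definition simple_graph :: "'a graph \<Rightarrow> bool" where
  "simple_graph G \<longleftrightarrow> finite (fst G) \<and> snd G \<subseteq> nsets (fst G) 2"

definition subgraph :: "'a graph \<Rightarrow> 'a graph \<Rightarrow> bool" where
  "subgraph H G \<longleftrightarrow> simple_graph H \<and> fst H \<subseteq> fst G \<and> snd H \<subseteq> snd G"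

definition graph_isomorphic :: "'a graph \<Rightarrow> 'b graph \<Rightarrow> bool" where
  "graph_isomorphic G H \<longleftrightarrow> (\<exists>\<phi>. bij_betw \<phi> (fst G) (fst H) \<and> (image \<phi>) ` snd G = snd H)"

definition contains_copy :: "'a graph \<Rightarrow> 'b graph \<Rightarrow> bool" where
  "contains_copy G F \<longleftrightarrow> (\<exists>H. subgraph H G \<and> graph_isomorphic H F)"

text \<open>The set under \<open>Max\<close> is finite, and it is nonempty whenever every member of \<open>\<FF>\<close> has an edge.\<close>

definition turan_number :: "nat \<Rightarrow> 'b graph set \<Rightarrow> nat" where
  "turan_number n \<FF> =
     Max {card E | E. simple_graph ({..<n}, E) \<and> (\<forall>F\<in>\<FF>. \<not> contains_copy ({..<n}, E) F)}"

definition complete_graph :: "nat \<Rightarrow> nat graph" where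
  "complete_graph m = ({..<m}, nsets {..<m} 2)"

definition complete_minus_matching :: "nat \<Rightarrow> nat graph" where
  "complete_minus_matching s = ({..<2 * s}, nsets {..<2 * s} 2 - {{2 * i, 2 * i + 1} | i. i < s})"

end

theory Submission
  imports Defs "HOL-Real_Asymp.Real_Asymp"
begin

text \<open>
  An \<open>(n - 2)\<close>-element edge \<open>H\<close> is the complement of a pair \<open>e\<close>. As \<open>s \<ge> 2\<close>, such an \<open>H\<close> crosses
  a partition into \<open>n - s\<close> classes iff it meets all of them, that is, iff no class lies inside \<open>e\<close>.
  So a hypergraph is a graph of pairs \<open>e\<close>, and it is convenient to describe it by the complementary
  graph \<open>E\<close>: the hypergraph fails to cross \<open>P\<close> iff every pair outside \<open>E\<close> contains a class
  of \<open>P\<close>.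

  Such a blocked \<open>P\<close> exists iff \<open>E\<close> contains \<open>K\<^bsub>s+1\<^esub>\<close> or the cocktail party graph
  \<open>K\<^bsub>2s\<^esub> - sK\<^sub>2\<close>. Given one of these subgraphs, its whole vertex set, respectively its
  \<open>s\<close> missing pairs, completed by singletons, is a blocked partition. Conversely, delete from the
  ground set one element of each class of size at most two. No class lies inside a pair of the
  remaining elements, so these form a clique of \<open>E\<close>; there are at least \<open>s\<close> of them, and more than
  \<open>s\<close> if some class has three elements. If all classes have at most two elements, then precisely
  \<open>s\<close> have two, and they are the non-edges of a cocktail party graph
  (lemma \<open>blocked_partition_iff\<close>). Minimising the hypergraph is therefore maximising \<open>E\<close>, which
  is (i).

  For (ii), both forbidden graphs contain the complete graph on \<open>s\<close> vertices, so an
  \<open>(s - 1)\<close>-colourable graph avoids them, and the balanced complete \<open>(s - 1)\<close>-partite graph bounds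
  the crossing number by \<open>n\<^sup>2 / (2 (s - 1))\<close>. In the other direction, the cocktail party graph is
  the complete \<open>s\<close>-partite graph with classes of size two, so the Erdos-Stone theorem bounds \<open>card E\<close>
  by \<open>(1 - 1 / (s - 1)) n\<^sup>2 / 2 + o(n\<^sup>2)\<close>. It is proved first under a degree condition
  (lemma \<open>erdos_stone_codegree\<close>), by induction on the number of classes, and then carried over to
  edge counts by deleting vertices of small degree one at a time (lemma \<open>erdos_stone_edges\<close>).
\<close>

section \<open>Cliques and cocktail party graphs as subsets of the ground set\<close>

definition has_clique :: "'a set \<Rightarrow> 'a set set \<Rightarrow> nat \<Rightarrow> bool" where
  "has_clique X E m \<longleftrightarrow> (\<exists>S. S \<subseteq> X \<and> finite S \<and> card S = m \<and> nsets S 2 \<subseteq> E)"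

text \<open>The members of \<open>M\<close> are the pairs of the removed perfect matching. They are allowed to be
  edges of \<open>E\<close>, since copies need not be induced.\<close>
definition has_cocktail_party :: "'a set \<Rightarrow> 'a set set \<Rightarrow> nat \<Rightarrow> bool" where
  "has_cocktail_party X E s \<longleftrightarrow>
     (\<exists>M. M \<subseteq> nsets X 2 \<and> finite M \<and> card M = s \<and> disjoint M \<and> nsets (\<Union>M) 2 - M \<subseteq> E)"

lemma simple_complete_graph: "simple_graph (complete_graph m)"
  by (simp add: simple_graph_def complete_graph_def)

lemma simple_complete_minus_matching: "simple_graph (complete_minus_matching s)"
  by (auto simp: simple_graph_def complete_minus_matching_def)

text \<open>An isomorphism from a subgraph onto \<open>F\<close> and an injective homomorphism from \<open>F\<close> are
  inverse to each other; the latter form does not mention the subgraph.\<close>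
lemma contains_copy_iff_embedding:
  assumes F: "simple_graph F"
  shows "contains_copy (V, E) F \<longleftrightarrow>
    (\<exists>f. inj_on f (fst F) \<and> f ` fst F \<subseteq> V \<and> (\<forall>e\<in>snd F. f ` e \<in> E))" (is "?L \<longleftrightarrow> ?R")
proof
  assume ?L
  then obtain H \<phi> where H: "simple_graph H" "fst H \<subseteq> V" "snd H \<subseteq> E"
    and \<phi>: "bij_betw \<phi> (fst H) (fst F)" "(image \<phi>) ` snd H = snd F"
    unfolding contains_copy_def subgraph_def graph_isomorphic_def by auto
  define f where "f = inv_into (fst H) \<phi>"
  have f: "bij_betw f (fst F) (fst H)"
    unfolding f_def using \<phi>(1) by (rule bij_betw_inv_into)
  have "f ` e \<in> E" if e: "e \<in> snd F" for e
  proof -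
    obtain d where d: "d \<in> snd H" "e = \<phi> ` d" using e \<phi>(2) by (metis imageE)
    have "d \<subseteq> fst H" using d(1) H(1) by (auto simp: simple_graph_def nsets_def)
    then have "f ` e = d"
      unfolding f_def d(2) using \<phi>(1) by (simp add: bij_betw_def inv_into_image_cancel)
    then show ?thesis using d(1) H(3) by auto
  qed
  then show ?R using f H(2) by (intro exI[of _ f]) (auto simp: bij_betw_def)
next
  assume ?R
  then obtain f where f: "inj_on f (fst F)" "f ` fst F \<subseteq> V" "\<forall>e\<in>snd F. f ` e \<in> E" by blast
  have sub: "snd F \<subseteq> nsets (fst F) 2" using F by (simp add: simple_graph_def)
  define H where "H = (f ` fst F, (image f) ` snd F)"
  have "subgraph H (V, E)"
    unfolding subgraph_def H_def simple_graph_def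
  proof (intro conjI)
    show "snd (f ` fst F, (image f) ` snd F) \<subseteq> nsets (fst (f ` fst F, (image f) ` snd F)) 2"
    proof clarsimp
      fix e assume "e \<in> snd F"
      then have e: "e \<subseteq> fst F" "finite e" "card e = 2" using sub by (auto simp: nsets_def)
      then have "card (f ` e) = 2" using card_image[OF inj_on_subset[OF f(1) e(1)]] by simp
      then show "f ` e \<in> nsets (f ` fst F) 2" using e by (auto simp: nsets_def)
    qed
  qed (use F f in \<open>auto simp: simple_graph_def\<close>)
  moreover have "graph_isomorphic H F"
    unfolding graph_isomorphic_def
  proof (intro exI conjI)
    show "bij_betw (inv_into (fst F) f) (fst H) (fst F)"
      unfolding H_def using f(1) by (simp add: bij_betw_inv_into inj_on_imp_bij_betw)
    have "inv_into (fst F) f ` f ` e = e" if "e \<in> snd F" for e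
    proof -
      have "e \<subseteq> fst F" using sub that by (auto simp: nsets_def)
      then show ?thesis using f(1) by (simp add: inv_into_image_cancel)
    qed
    then show "(image (inv_into (fst F) f)) ` snd H = snd F"
      unfolding H_def by (simp add: image_image)
  qed
  ultimately show ?L unfolding contains_copy_def by blast
qed

lemma contains_complete_graph_iff:
  "contains_copy (V, E) (complete_graph m) \<longleftrightarrow> has_clique V E m"
proof -
  have "(\<exists>f. inj_on f {..<m} \<and> f ` {..<m} \<subseteq> V \<and> (\<forall>e\<in>nsets {..<m} 2. f ` e \<in> E))
    \<longleftrightarrow> has_clique V E m" (is "?L \<longleftrightarrow> ?R")
  proof
    assume ?L
    then obtain f where f: "inj_on f {..<m}" "f ` {..<m} \<subseteq> V" "\<forall>e\<in>nsets {..<m} 2. f ` e \<in> E"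
      by blast
    have "e \<in> E" if "e \<in> nsets (f ` {..<m}) 2" for e
    proof -
      from that obtain x y
        where "e = {x, y}" "x \<in> f ` {..<m}" "y \<in> f ` {..<m}" "x \<noteq> y" by (rule nsets2_E)
      then obtain i j where ij: "i < m" "j < m" "e = {f i, f j}" "f i \<noteq> f j" by blast
      then have "{i, j} \<in> nsets {..<m} 2" by auto
      then show ?thesis using f(3) ij(3) by (metis image_empty image_insert)
    qed
    then show ?R
      unfolding has_clique_def using f(1,2) by (intro exI[of _ "f ` {..<m}"]) (auto simp: card_image)
  next
    assume ?R
    then obtain S where S: "S \<subseteq> V" "finite S" "card S = m" "nsets S 2 \<subseteq> E"
      unfolding has_clique_def by blast
    then obtain f where f: "bij_betw f {..<m} S"
      by (metis bij_betw_from_nat_into_finite ex_bij_betw_nat_finite lessThan_atLeast0)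
    have "f ` e \<in> E" if "e \<in> nsets {..<m} 2" for e
    proof -
      from that obtain i j where "e = {i, j}" "i \<in> {..<m}" "j \<in> {..<m}" "i \<noteq> j"
        by (rule nsets2_E)
      then have "f ` e \<in> nsets S 2" using f by (auto simp: bij_betw_def inj_on_def)
      then show ?thesis using S by auto
    qed
    then show ?L using f S(1) by (intro exI[of _ f]) (auto simp: bij_betw_def)
  qed
  then show ?thesis
    by (simp add: contains_copy_iff_embedding simple_complete_graph) (simp add: complete_graph_def)
qed

lemma contains_complete_minus_matching_iff:
  "contains_copy (V, E) (complete_minus_matching s) \<longleftrightarrow> has_cocktail_party V E s"
proof -
  let ?M = "{{2 * i, 2 * i + 1} | i::nat. i < s}"
  have "(\<exists>f. inj_on f {..<2*s} \<and> f ` {..<2*s} \<subseteq> V \<and> (\<forall>e\<in>nsets {..<2*s} 2 - ?M. f ` e \<in> E))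
    \<longleftrightarrow> has_cocktail_party V E s" (is "?L \<longleftrightarrow> ?R")
  proof
    assume ?L
    then obtain f where f: "inj_on f {..<2*s}" "f ` {..<2*s} \<subseteq> V"
        "\<forall>e\<in>nsets {..<2*s} 2 - ?M. f ` e \<in> E"
      by blast
    \<comment> \<open>the images of the removed matching edges\<close>
    define c where "c i = {f (2*i), f (2*i+1)}" for i
    define M where "M = c ` {..<s}"
    have feq: "f a = f b \<longleftrightarrow> a = b" if "a < 2*s" "b < 2*s" for a b
      using f(1) that by (auto simp: inj_on_def)
    have odd_even: "2 * i < 2 * s" "2 * i + 1 < 2 * s" if "i < s" for i using that by auto
    have meet: "i = j" if "i < s" "j < s" "c i \<inter> c j \<noteq> {}" for i j
    proof -
      have "2*i = 2*j \<or> 2*i = 2*j+1 \<or> 2*i+1 = 2*j \<or> 2*i+1 = 2*j+1"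
        using that feq odd_even by (auto simp: c_def)
      then show ?thesis by presburger
    qed
    have "inj_on c {..<s}"
    proof (rule inj_onI)
      fix i j assume "i \<in> {..<s}" "j \<in> {..<s}" "c i = c j"
      then show "i = j" by (intro meet) (auto simp: c_def)
    qed
    then have "card M = s" by (simp add: M_def card_image)
    moreover have "disjoint M"
      unfolding M_def pairwise_def disjnt_def using meet by blast
    moreover have "M \<subseteq> nsets V 2"
    proof
      fix d assume "d \<in> M"
      then obtain i where i: "i < s" "d = c i" by (auto simp: M_def)
      then have "f (2*i) \<in> V" "f (2*i+1) \<in> V" using f(2) by auto
      then show "d \<in> nsets V 2" using i feq[OF odd_even[OF i(1)]] by (simp add: c_def)
    qed
    moreover have "nsets (\<Union>M) 2 - M \<subseteq> E"
    proof
      fix e assume e: "e \<in> nsets (\<Union>M) 2 - M"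
      have un: "\<Union>M \<subseteq> f ` {..<2*s}" using odd_even by (auto simp: M_def c_def)
      from e have "e \<in> nsets (\<Union>M) 2" by blast
      then obtain x y where xy: "e = {x, y}" "x \<in> \<Union>M" "y \<in> \<Union>M" "x \<noteq> y"
        by (rule nsets2_E)
      then have "x \<in> f ` {..<2*s}" "y \<in> f ` {..<2*s}" using un by blast+
      then obtain a b where ab: "a < 2*s" "b < 2*s" "e = {f a, f b}" "f a \<noteq> f b"
        using xy by auto
      have "{a, b} \<notin> ?M"
      proof
        assume "{a, b} \<in> ?M"
        then obtain i where i: "i < s" "{a, b} = {2*i, 2*i+1}" by auto
        then have "f ` {a, b} = c i" unfolding i(2) c_def by simp
        then have "e = c i" using ab by simp
        then show False using e i(1) by (auto simp: M_def)
      qed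
      moreover have "{a, b} \<in> nsets {..<2*s} 2" using ab by auto
      ultimately have "f ` {a, b} \<in> E" using f(3) by blast
      then show "e \<in> E" using ab(3) by simp
    qed
    ultimately show ?R unfolding has_cocktail_party_def by (intro exI[of _ M]) (auto simp: M_def)
  next
    assume ?R
    then obtain M where M: "M \<subseteq> nsets V 2" "finite M" "card M = s" "disjoint M"
        "nsets (\<Union>M) 2 - M \<subseteq> E"
      unfolding has_cocktail_party_def by blast
    obtain c where c: "bij_betw c {..<s} M"
      using M(2,3) by (metis ex_bij_betw_nat_finite lessThan_atLeast0)
    have "\<forall>i\<in>{..<s}. \<exists>x y. x \<noteq> y \<and> c i = {x, y}"
    proof
      fix i assume "i \<in> {..<s}"
      then have "c i \<in> nsets V 2" using c M(1) by (auto simp: bij_betw_def)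
      then show "\<exists>x y. x \<noteq> y \<and> c i = {x, y}" by (auto elim!: nsets2_E)
    qed
    then obtain x y where xy: "\<And>i. i < s \<Longrightarrow> x i \<noteq> y i \<and> c i = {x i, y i}"
      by (simp add: Ball_def) metis
    \<comment> \<open>The pair with index \<open>i\<close> becomes the image of the removed edge \<open>{2 * i, 2 * i + 1}\<close>.\<close>
    define f where "f a = (if even a then x (a div 2) else y (a div 2))" for a
    have fc: "f a \<in> c (a div 2)" if "a < 2*s" for a
      using xy[of "a div 2"] that by (auto simp: f_def)
    have cM: "c i \<in> M" if "i < s" for i using c that by (auto simp: bij_betw_def)
    have cinj: "i = j" if "i < s" "j < s" "z \<in> c i" "z \<in> c j" for i j z
    proof -
      have "c i = c j" using cM[OF that(1)] cM[OF that(2)] M(4) that(3,4)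
        by (auto simp: pairwise_def disjnt_def)
      then show ?thesis using c that by (auto simp: bij_betw_def inj_on_def)
    qed
    have same: "a = b" if "a < 2*s" "b < 2*s" "f a = f b" for a b
    proof -
      have d: "a div 2 = b div 2"
        using that fc[OF that(1)] fc[OF that(2)] by (intro cinj[of _ _ "f a"]) auto
      have "even a = even b"
        using that xy[of "a div 2"] d by (auto simp: f_def split: if_splits)
      then show ?thesis using d by (metis div_mult_mod_eq parity_cases)
    qed
    have in_un: "f a \<in> \<Union>M" if "a < 2*s" for a
      using fc[OF that] cM[of "a div 2"] that by auto
    have "f ` e \<in> E" if e: "e \<in> nsets {..<2*s} 2 - ?M" for e
    proof -
      obtain a b where ab: "a < 2*s" "b < 2*s" "e = {a, b}" "a \<noteq> b"
        using e by (auto elim!: nsets2_E)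
      have "f ` e \<notin> M"
      proof
        assume "f ` e \<in> M"
        then obtain i where i: "i < s" "f ` e = c i" using c by (auto simp: bij_betw_def)
        have "a div 2 = i" "b div 2 = i"
          using ab i fc[of a] fc[of b] by (auto intro!: cinj[of _ i])
        then have "a = 2*i \<and> b = 2*i+1 \<or> a = 2*i+1 \<and> b = 2*i" using ab(4) by presburger
        then have "e = {2*i, 2*i+1}" using ab(3) by auto
        then show False using e i(1) by auto
      qed
      moreover have "f ` e \<in> nsets (\<Union>M) 2"
        using ab same in_un by auto
      ultimately show ?thesis using M(5) by blast
    qed
    moreover have "inj_on f {..<2*s}" using same by (auto intro: inj_onI)
    moreover have "f ` {..<2*s} \<subseteq> V"
      using in_un M(1) by (fastforce simp: nsets_def)
    ultimately show ?L by blast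
  qed
  then show ?thesis
    by (simp add: contains_copy_iff_embedding simple_complete_minus_matching)
       (simp add: complete_minus_matching_def)
qed

section \<open>Partitions with a class inside every non-edge\<close>

lemma card_Union_of_pairs:
  assumes "M \<subseteq> nsets X 2" "disjoint M"
  shows "card (\<Union>M) = 2 * card M"
proof -
  have "card (\<Union>M) = sum card M"
    using assms by (intro card_Union_disjoint) (auto simp: nsets_def)
  also have "\<dots> = (\<Sum>C\<in>M. 2)" using assms(1) by (intro sum.cong) (auto simp: nsets_def)
  finally show ?thesis by simp
qed

lemma partition_by_singletons:
  assumes "finite X" "\<Union>Q \<subseteq> X" "disjoint Q" "{} \<notin> Q"
  shows "k_partition (card Q + (card X - card (\<Union>Q))) X (Q \<union> (\<lambda>x. {x}) ` (X - \<Union>Q))"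
proof -
  have fin: "finite Q" "finite (\<Union>Q)"
    using assms(1,2) by (auto intro: finite_subset finite_UnionD)
  have "card (Q \<union> (\<lambda>x. {x}) ` (X - \<Union>Q)) = card Q + card ((\<lambda>x. {x}) ` (X - \<Union>Q))"
    using fin assms(1) by (intro card_Un_disjoint) auto
  also have "card ((\<lambda>x. {x}) ` (X - \<Union>Q)) = card X - card (\<Union>Q)"
    using fin assms(2) by (simp add: card_image card_Diff_subset)
  finally show ?thesis
    using assms fin unfolding k_partition_def partition_on_def pairwise_def disjnt_def by auto
qed

text \<open>The partition consists of the clique and singletons: a non-edge leaves the clique, hence
  contains a singleton class.\<close>
lemma blocked_partition_of_clique:
  assumes X: "finite X" and "has_clique X E (Suc s)"
  shows "\<exists>P. k_partition (card X - s) X P \<and> (\<forall>e\<in>nsets X 2 - E. \<exists>C\<in>P. C \<subseteq> e)"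
proof -
  obtain S where S: "S \<subseteq> X" "finite S" "card S = Suc s" "nsets S 2 \<subseteq> E"
    using assms unfolding has_clique_def by blast
  let ?P = "{S} \<union> (\<lambda>x. {x}) ` (X - S)"
  have "card S \<le> card X" using S X card_mono by blast
  then have "1 + (card X - card S) = card X - s" using S(3) by simp
  moreover have "S \<noteq> {}" using S(3) by auto
  ultimately have "k_partition (card X - s) X ?P"
    using partition_by_singletons[OF X, of "{S}"] S by simp
  moreover have "\<exists>C\<in>?P. C \<subseteq> e" if e: "e \<in> nsets X 2 - E" for e
  proof -
    have "\<not> e \<subseteq> S" using S(4) e by (auto simp: nsets_def)
    then show ?thesis using e by (auto simp: nsets_def)
  qed
  ultimately show ?thesis by blast
qed

text \<open>The partition consists of the matching and singletons: a non-edge either belongs to the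
  matching or leaves the vertex set of the cocktail party graph.\<close>
lemma blocked_partition_of_cocktail_party:
  assumes X: "finite X" and "has_cocktail_party X E s"
  shows "\<exists>P. k_partition (card X - s) X P \<and> (\<forall>e\<in>nsets X 2 - E. \<exists>C\<in>P. C \<subseteq> e)"
proof -
  obtain M where M: "M \<subseteq> nsets X 2" "finite M" "card M = s" "disjoint M"
      "nsets (\<Union>M) 2 - M \<subseteq> E"
    using assms unfolding has_cocktail_party_def by blast
  let ?P = "M \<union> (\<lambda>x. {x}) ` (X - \<Union>M)"
  have sub: "\<Union>M \<subseteq> X" "{} \<notin> M" using M(1) by (auto simp: nsets_def)
  have c: "card (\<Union>M) = 2 * s" using card_Union_of_pairs[OF M(1,4)] M(3) by simp
  have "card (\<Union>M) \<le> card X" using sub X card_mono by blast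
  then have "card M + (card X - card (\<Union>M)) = card X - s" using M(3) c by simp
  then have "k_partition (card X - s) X ?P"
    using partition_by_singletons[OF X sub(1) M(4) sub(2)] by simp
  moreover have "\<exists>C\<in>?P. C \<subseteq> e" if e: "e \<in> nsets X 2 - E" for e
  proof (cases "e \<subseteq> \<Union>M")
    case True
    then have "e \<in> nsets (\<Union>M) 2" using e by (auto simp: nsets_def)
    then have "e \<in> M" using M(5) e by blast
    then show ?thesis by blast
  next
    case False
    then obtain x where "x \<in> e" "x \<notin> \<Union>M" by blast
    then have "{x} \<in> ?P" "{x} \<subseteq> e" using e by (auto simp: nsets_def)
    then show ?thesis by blast
  qed
  ultimately show ?thesis by blast
qed

text \<open>A pair that contains no class is an edge, so it suffices to find vertex sets whose pairs
  contain no class. If some class has at least three elements, one deletes an element of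
  every smaller class: fewer than \<open>card X - s\<close> elements disappear and every class inside a pair
  has lost one. If there is no such class, counting shows that the two-element classes
  number precisely \<open>s\<close>, and they serve as the matching.\<close>
lemma clique_or_cocktail_party_of_blocked_partition:
  assumes X: "finite X" "s < card X" and P: "k_partition (card X - s) X P"
    and block: "\<forall>e\<in>nsets X 2 - E. \<exists>C\<in>P. C \<subseteq> e"
  shows "has_clique X E (Suc s) \<or> has_cocktail_party X E s"
proof -
  have part: "partition_on X P" "finite P" "card P = card X - s"
    using P by (auto simp: k_partition_def)
  have PX: "\<Union>P = X" and disj: "disjoint P" and ne: "{} \<notin> P"
    using part(1) by (auto simp: partition_on_def)
  have fin: "finite C" if "C \<in> P" for C using that PX X(1) by (metis Sup_upper finite_subset)
  have pos: "card C > 0" if "C \<in> P" for C using that fin ne by (metis card_gt_0_iff)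
  have edge: "e \<in> E" if "e \<in> nsets X 2" "\<And>C. C \<in> P \<Longrightarrow> \<not> C \<subseteq> e" for e
    using that block by blast
  show ?thesis
  proof (cases "\<exists>D\<in>P. card D > 2")
    case True
    then obtain D where D: "D \<in> P" "card D > 2" by blast
    define Q where "Q = {C \<in> P. card C \<le> 2}"
    obtain h where h: "\<And>C. C \<in> P \<Longrightarrow> h C \<in> C" using ne by (metis ex_in_conv)
    \<comment> \<open>\<open>D\<close> is not in \<open>Q\<close>, so at most \<open>card X - s - 1\<close> elements are deleted.\<close>
    define K where "K = X - h ` Q"
    have "card (h ` Q) \<le> card (P - {D})"
      using D part(2) by (intro order_trans[OF card_image_le card_mono]) (auto simp: Q_def)
    also have "\<dots> = card X - s - 1" using D part by simp
    finally have "card (h ` Q) \<le> card X - s - 1" .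
    moreover have "card K = card X - card (h ` Q)"
      unfolding K_def using h PX part(2) by (intro card_Diff_subset) (auto simp: Q_def)
    ultimately have "Suc s \<le> card K" using X(2) by linarith
    then obtain S where S: "S \<subseteq> K" "card S = Suc s" "finite S" by (rule obtain_subset_with_card_n)
    have "e \<in> E" if e: "e \<in> nsets S 2" for e
    proof (rule edge)
      have eK: "e \<subseteq> K" "finite e" "card e = 2" using e S by (auto simp: nsets_def)
      then show "e \<in> nsets X 2" by (auto simp: nsets_def K_def)
      fix C assume C: "C \<in> P"
      show "\<not> C \<subseteq> e"
      proof
        assume "C \<subseteq> e"
        then have "card C \<le> 2" using eK card_mono by metis
        then have "h C \<in> h ` Q" using C by (simp add: Q_def)
        then show False using h[OF C] \<open>C \<subseteq> e\<close> eK by (auto simp: K_def)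
      qed
    qed
    then have "has_clique X E (Suc s)"
      unfolding has_clique_def using S by (intro exI[of _ S]) (auto simp: K_def)
    then show ?thesis ..
  next
    case False
    then have small: "card C = 1 \<or> card C = 2" if "C \<in> P" for C
      using that pos[OF that] by (metis Suc_leI One_nat_def le_antisym not_less_eq_eq not_le numeral_2_eq_2)
    define M where "M = {C \<in> P. card C = 2}"
    \<comment> \<open>Each class accounts for one element, and each pair for one more.\<close>
    have "card X = (\<Sum>C\<in>P. card C)" using part(1) fin by (intro product_partition)
    also have "\<dots> = (\<Sum>C\<in>P. 1 + (if card C = 2 then 1 else 0))"
      using small by (intro sum.cong) auto
    also have "\<dots> = card P + card M"
      unfolding M_def sum.distrib using part(2) by (simp add: sum.If_cases Int_def)
    finally have "card M = s" using part(3) X(2) by linarith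
    moreover have "M \<subseteq> nsets X 2" using PX fin by (auto simp: M_def nsets_def)
    moreover have "disjoint M" using disj by (auto simp: M_def pairwise_def)
    moreover have "e \<in> E" if e: "e \<in> nsets (\<Union>M) 2 - M" for e
    proof (rule edge)
      have e2: "e \<subseteq> \<Union>M" "finite e" "card e = 2" "e \<notin> M" using e by (auto simp: nsets_def)
      then show "e \<in> nsets X 2" using PX by (auto simp: nsets_def M_def)
      fix C assume C: "C \<in> P"
      show "\<not> C \<subseteq> e"
      proof
        assume sub: "C \<subseteq> e"
        obtain z where z: "z \<in> C" using C ne by (metis ex_in_conv)
        then obtain D where D: "D \<in> M" "z \<in> D" using sub e2 by blast
        then have "C = D" using disj C z by (auto simp: M_def pairwise_def disjnt_def)
        then have "card C = 2" using D by (simp add: M_def)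
        then have "C = e" using sub e2 card_subset_eq by metis
        then show False using \<open>C = D\<close> D e2 by simp
      qed
    qed
    ultimately have "has_cocktail_party X E s"
      unfolding has_cocktail_party_def using part(2) by (intro exI[of _ M]) (auto simp: M_def)
    then show ?thesis ..
  qed
qed

lemma blocked_partition_iff:
  assumes "finite X" "s < card X"
  shows "(\<exists>P. k_partition (card X - s) X P \<and> (\<forall>e\<in>nsets X 2 - E. \<exists>C\<in>P. C \<subseteq> e)) \<longleftrightarrow>
    has_clique X E (Suc s) \<or> has_cocktail_party X E s"
  using blocked_partition_of_clique[OF assms(1)] blocked_partition_of_cocktail_party[OF assms(1)]
    clique_or_cocktail_party_of_blocked_partition[OF assms]
  by metis

section \<open>The crossing number as the complement of a Turan number\<close>

text \<open>With at most \<open>card X - 2\<close> classes, crossing means to meet every class, and \<open>X - e\<close> misses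
  exactly the classes inside \<open>e\<close>.\<close>
lemma set_crosses_complement_iff:
  assumes X: "finite X" and P: "k_partition k X P" and e: "e \<in> nsets X 2"
    and k: "k \<le> card X - 2"
  shows "set_crosses (X - e) P \<longleftrightarrow> (\<forall>C\<in>P. \<not> C \<subseteq> e)"
proof -
  have part: "\<Union>P = X" "finite P" "card P = k"
    using P by (auto simp: k_partition_def partition_on_def)
  have "e \<subseteq> X" "finite e" "card e = 2" using e by (auto simp: nsets_def)
  then have "min (card (X - e)) (card P) = card P"
    using k part X by (simp add: card_Diff_subset)
  moreover have "{C \<in> P. (X - e) \<inter> C \<noteq> {}} = {C \<in> P. \<not> C \<subseteq> e}"
    using part(1) by blast
  moreover have "card {C \<in> P. \<not> C \<subseteq> e} = card P \<longleftrightarrow> {C \<in> P. \<not> C \<subseteq> e} = P"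
    using part(2) by (metis (no_types, lifting) card_subset_eq mem_Collect_eq subsetI)
  ultimately show ?thesis unfolding set_crosses_def by auto
qed

lemma bij_betw_complement_nsets:
  assumes "finite X" "k \<le> card X"
  shows "bij_betw (\<lambda>A. X - A) (nsets X k) (nsets X (card X - k))"
proof (rule bij_betw_byWitness[where f' = "\<lambda>A. X - A"])
  show "(\<lambda>A. X - A) ` nsets X k \<subseteq> nsets X (card X - k)"
    using assms by (auto simp: nsets_def card_Diff_subset)
  show "(\<lambda>A. X - A) ` nsets X (card X - k) \<subseteq> nsets X k"
    using assms by (auto simp: nsets_def card_Diff_subset)
qed (auto simp: nsets_def)

definition clique_cocktail_free :: "nat \<Rightarrow> nat \<Rightarrow> nat set set \<Rightarrow> bool" where
  "clique_cocktail_free n s E \<longleftrightarrow> E \<subseteq> nsets {..<n} 2 \<and>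
     \<not> has_clique {..<n} E (Suc s) \<and> \<not> has_cocktail_party {..<n} E s"

text \<open>The hypergraph consists of the complements of the non-edges of \<open>E\<close>, so a partition that it
  does not cross is one that has a class inside every non-edge.\<close>
lemma complement_crosses_iff:
  assumes s: "2 \<le> s" "s < n" and E: "E \<subseteq> nsets {..<n} 2"
  shows "(\<forall>P. k_partition (n - s) {..<n} P \<longrightarrow>
            hypergraph_crosses ((\<lambda>e. {..<n} - e) ` (nsets {..<n} 2 - E)) P)
         \<longleftrightarrow> clique_cocktail_free n s E"
proof -
  have "hypergraph_crosses ((\<lambda>e. {..<n} - e) ` (nsets {..<n} 2 - E)) P \<longleftrightarrow>
      \<not> (\<forall>e\<in>nsets {..<n} 2 - E. \<exists>C\<in>P. C \<subseteq> e)"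
    if "k_partition (n - s) {..<n} P" for P
    using that s by (simp add: hypergraph_crosses_def set_crosses_complement_iff[of "{..<n}" "n - s"])
  then have "(\<forall>P. k_partition (n - s) {..<n} P \<longrightarrow>
            hypergraph_crosses ((\<lambda>e. {..<n} - e) ` (nsets {..<n} 2 - E)) P) \<longleftrightarrow>
      \<not> (\<exists>P. k_partition (n - s) {..<n} P \<and> (\<forall>e\<in>nsets {..<n} 2 - E. \<exists>C\<in>P. C \<subseteq> e))"
    by (simp cong: imp_cong)
  also have "\<dots> \<longleftrightarrow> clique_cocktail_free n s E"
    using blocked_partition_iff[of "{..<n}" s E] s(2) E
    unfolding clique_cocktail_free_def by (simp del: Diff_iff)
  finally show ?thesis .
qed

text \<open>Both forbidden graphs contain a clique on \<open>s\<close> vertices (choose one vertex of each removed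
  edge), and a proper colouring with fewer than \<open>s\<close> colours excludes such a clique.\<close>
lemma clique_cocktail_free_if_colourable:
  assumes E: "E \<subseteq> nsets {..<n} 2" and c: "c \<in> {..<n} \<rightarrow> {..<r}" "r < s"
    and proper: "\<And>x y. {x, y} \<in> E \<Longrightarrow> c x \<noteq> c y"
  shows "clique_cocktail_free n s E"
proof -
  have small: "card S \<le> r" if S: "S \<subseteq> {..<n}" "nsets S 2 \<subseteq> E" for S
  proof -
    have "inj_on c S"
    proof (rule inj_onI, rule ccontr)
      fix x y assume "x \<in> S" "y \<in> S" "c x = c y" "x \<noteq> y"
      then have "{x, y} \<in> E" using S(2) by auto
      then show False using proper \<open>c x = c y\<close> by blast
    qed
    moreover have "c ` S \<subseteq> {..<r}" using c(1) S(1) by auto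
    ultimately show ?thesis using card_inj_on_le[of c S "{..<r}"] by simp
  qed
  have "\<not> has_clique {..<n} E (Suc s)"
  proof
    assume "has_clique {..<n} E (Suc s)"
    then obtain S where "S \<subseteq> {..<n}" "card S = Suc s" "nsets S 2 \<subseteq> E"
      unfolding has_clique_def by blast
    then show False using small[of S] c(2) by simp
  qed
  moreover have "\<not> has_cocktail_party {..<n} E s"
  proof
    assume "has_cocktail_party {..<n} E s"
    then obtain M where M: "M \<subseteq> nsets {..<n} 2" "finite M" "card M = s" "disjoint M"
        "nsets (\<Union>M) 2 - M \<subseteq> E"
      unfolding has_cocktail_party_def by blast
    have "C \<noteq> {}" if "C \<in> M" for C using M(1) that by (auto simp: nsets_def)
    then obtain h where h: "\<And>C. C \<in> M \<Longrightarrow> h C \<in> C" by (metis ex_in_conv)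
    have meet: "C = D" if "C \<in> M" "D \<in> M" "x \<in> C" "x \<in> D" for C D x
      using M(4) that by (auto simp: pairwise_def disjnt_def)
    have "inj_on h M"
    proof (rule inj_onI)
      fix C D assume "C \<in> M" "D \<in> M" "h C = h D"
      then show "C = D" using meet[of C D "h C"] h[of C] h[of D] by simp
    qed
    then have "card (h ` M) = s" using M(3) by (simp add: card_image)
    moreover have "card (h ` M) \<le> r"
    proof (rule small)
      show "h ` M \<subseteq> {..<n}" using h M(1) by (fastforce simp: nsets_def)
      show "nsets (h ` M) 2 \<subseteq> E"
      proof
        fix e assume "e \<in> nsets (h ` M) 2"
        then obtain x y where "e = {x, y}" "x \<in> h ` M" "y \<in> h ` M" "x \<noteq> y" by (rule nsets2_E)
        then obtain C D where CD: "e = {h C, h D}" "C \<in> M" "D \<in> M" "h C \<noteq> h D" by blast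
        have "e \<notin> M"
        proof
          assume "e \<in> M"
          then have "C = e" "D = e"
            using meet[of C e "h C"] meet[of D e "h D"] CD h by auto
          then show False using CD(4) by simp
        qed
        moreover have "e \<in> nsets (\<Union>M) 2" using CD h by auto
        ultimately show "e \<in> E" using M(5) by blast
      qed
    qed
    ultimately show False using c(2) by simp
  qed
  ultimately show ?thesis using E by (simp add: clique_cocktail_free_def)
qed

text \<open>The bijection between hypergraphs and graphs turns the minimum that defines the crossing
  number into the maximum that defines the Turan number. The extremal graph \<open>E\<close> is
  exposed because the asymptotic estimates bound its number of edges.\<close>
lemma crossing_number_turan:
  assumes s: "2 \<le> s" "s < n"
  obtains E where "clique_cocktail_free n s E"
    and "\<And>E'. clique_cocktail_free n s E' \<Longrightarrow> card E' \<le> card E"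
    and "turan_number n {complete_graph (s + 1), complete_minus_matching s} = card E"
    and "crossing_number n (n - s) (n - 2) + card E = n choose 2"
proof -
  let ?N = "nsets {..<n} 2"
  let ?T = "{card E | E. clique_cocktail_free n s E}"
  have finN: "finite ?N" by (simp add: finite_imp_finite_nsets)
  have sub: "E \<subseteq> ?N" if "clique_cocktail_free n s E" for E
    using that by (simp add: clique_cocktail_free_def)
  have "finite ?T"
  proof (rule finite_subset)
    show "?T \<subseteq> card ` Pow ?N" using sub by blast
    show "finite (card ` Pow ?N)" using finN by simp
  qed
  \<comment> \<open>The maximum is over a nonempty set: the edgeless graph is coloured with one colour.\<close>
  have "clique_cocktail_free n s {}"
    using s(1) by (intro clique_cocktail_free_if_colourable[of "{}" n "\<lambda>_. 0" 1]) auto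
  then have "?T \<noteq> {}" by blast
  have "Max ?T \<in> ?T" using \<open>finite ?T\<close> \<open>?T \<noteq> {}\<close> by (rule Max_in)
  then obtain E where E: "clique_cocktail_free n s E" "Max ?T = card E" by auto
  have max: "card E' \<le> card E" if "clique_cocktail_free n s E'" for E'
    using that \<open>finite ?T\<close> by (auto intro!: Max_ge simp flip: E(2))
  have "turan_number n {complete_graph (s + 1), complete_minus_matching s} = Max ?T"
    unfolding turan_number_def
    by (simp add: contains_complete_graph_iff contains_complete_minus_matching_iff
        simple_graph_def clique_cocktail_free_def conj_ac)
  moreover have "crossing_number n (n - s) (n - 2) = (n choose 2) - card E"
    unfolding crossing_number_def
  proof (rule Min_eqI)
    let ?F = "{\<H>. \<H> \<subseteq> nsets {..<n} (n - 2) \<and>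
       (\<forall>P. k_partition (n - s) {..<n} P \<longrightarrow> hypergraph_crosses \<H> P)}"
    let ?c = "\<lambda>e. {..<n} - e"
    have bij: "bij_betw ?c ?N (nsets {..<n} (n - 2))"
      using bij_betw_complement_nsets[of "{..<n}" 2] s by simp
    have card_c: "card (?c ` (?N - E')) = (n choose 2) - card E'" if "E' \<subseteq> ?N" for E'
    proof -
      have "card (?c ` (?N - E')) = card (?N - E')"
        using bij by (intro card_image) (auto simp: bij_betw_def intro: inj_on_subset)
      then show ?thesis using that finN by (simp add: card_Diff_subset finite_subset)
    qed
    show "finite (card ` ?F)"
      by (rule finite_imageI, rule finite_subset[of _ "Pow (nsets {..<n} (n - 2))"])
        (auto simp: finite_imp_finite_nsets)
    have "?c ` (?N - E) \<in> ?F"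
      using complement_crosses_iff[OF s sub[OF E(1)]] E(1) bij by (auto simp: bij_betw_def)
    then show "(n choose 2) - card E \<in> card ` ?F"
      using card_c[OF sub[OF E(1)]] by (rule image_eqI[OF sym, rotated])
    fix m assume "m \<in> card ` ?F"
    then obtain \<H> where \<H>: "m = card \<H>" "\<H> \<subseteq> nsets {..<n} (n - 2)"
      "\<forall>P. k_partition (n - s) {..<n} P \<longrightarrow> hypergraph_crosses \<H> P" by auto
    define E' where "E' = {e \<in> ?N. ?c e \<notin> \<H>}"
    have E': "E' \<subseteq> ?N" by (auto simp: E'_def)
    have eq: "\<H> = ?c ` (?N - E')"
    proof -
      have "\<H> \<subseteq> ?c ` ?N" using \<H>(2) bij by (simp add: bij_betw_def)
      then show ?thesis unfolding E'_def by blast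
    qed
    have "clique_cocktail_free n s E'"
      using complement_crosses_iff[OF s E'] \<H>(3) unfolding eq by (rule iffD1)
    moreover have "m = (n choose 2) - card E'"
      using card_c[OF E'] unfolding \<H>(1) eq .
    ultimately show "(n choose 2) - card E \<le> m" using max by (simp add: diff_le_mono2)
  qed
  moreover have "card E \<le> n choose 2"
    using card_mono[OF finN sub[OF E(1)]] by simp
  ultimately show thesis using that E max by simp
qed

section \<open>The Erdos-Stone theorem\<close>

text \<open>Disjointness of the classes is automatic as soon as no singleton belongs to \<open>E\<close>.\<close>
definition has_complete_multipartite :: "'a set \<Rightarrow> 'a set set \<Rightarrow> nat \<Rightarrow> nat \<Rightarrow> bool" where
  "has_complete_multipartite V E q t \<longleftrightarrow>
     (\<exists>A. (\<forall>i<q. A i \<in> nsets V t) \<and> (\<forall>i<q. \<forall>j<i. \<forall>x\<in>A i. \<forall>y\<in>A j. {x, y} \<in> E))"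

lemma has_complete_multipartite_mono:
  assumes "has_complete_multipartite V E q t" "V \<subseteq> V'" "E \<subseteq> E'"
  shows "has_complete_multipartite V' E' q t"
proof -
  from assms(1) obtain A where "\<forall>i<q. A i \<in> nsets V t"
    and "\<forall>i<q. \<forall>j<i. \<forall>x\<in>A i. \<forall>y\<in>A j. {x, y} \<in> E"
    unfolding has_complete_multipartite_def by (elim exE conjE)
  then show ?thesis
    unfolding has_complete_multipartite_def using assms(2,3) nsets_mono[of V V' t]
    by (intro exI[of _ A]) (simp add: subset_iff)
qed

text \<open>The classes of size two are the pairs of the matching; they are disjoint because a common
  vertex would have to be adjacent to itself.\<close>
lemma has_cocktail_party_if_multipartite:
  assumes E: "E \<subseteq> nsets V 2" and "has_complete_multipartite V E q 2"
  shows "has_cocktail_party V E q"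
proof -
  from assms(2) obtain A where "\<forall>i<q. A i \<in> nsets V 2"
    and "\<forall>i<q. \<forall>j<i. \<forall>x\<in>A i. \<forall>y\<in>A j. {x, y} \<in> E"
    unfolding has_complete_multipartite_def by (elim exE conjE)
  note A = this(1)[rule_format] and less = this(2)[rule_format]
  have edge: "{x, y} \<in> E" if "i < q" "j < q" "i \<noteq> j" "x \<in> A i" "y \<in> A j" for i j x y
    using less[of i j x y] less[of j i y x] that by (cases "j < i") (auto simp: insert_commute)
  have meet: "i = j" if "i < q" "j < q" "x \<in> A i" "x \<in> A j" for i j x
  proof (rule ccontr)
    assume "i \<noteq> j"
    then have "{x, x} \<in> nsets V 2" using edge that E by blast
    then show False by (simp add: nsets_def)
  qed
  have ne: "A i \<noteq> {}" if "i < q" for i using A[OF that] by (auto simp: nsets_def)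
  have "inj_on A {..<q}"
  proof (rule inj_onI)
    fix i j assume "i \<in> {..<q}" "j \<in> {..<q}" "A i = A j"
    then show "i = j" using meet[of i j] ne[of i] by auto
  qed
  then have "card (A ` {..<q}) = q" by (simp add: card_image)
  moreover have "A ` {..<q} \<subseteq> nsets V 2" using A by auto
  moreover have "disjoint (A ` {..<q})"
    using meet unfolding pairwise_def disjnt_def by blast
  moreover have "nsets (\<Union>(A ` {..<q})) 2 - A ` {..<q} \<subseteq> E"
  proof
    fix e assume e: "e \<in> nsets (\<Union>(A ` {..<q})) 2 - A ` {..<q}"
    then have "e \<in> nsets (\<Union>(A ` {..<q})) 2" by blast
    then obtain x y where xy: "e = {x, y}" "x \<in> \<Union>(A ` {..<q})" "y \<in> \<Union>(A ` {..<q})" "x \<noteq> y"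
      by (rule nsets2_E)
    then obtain i j where ij: "i < q" "j < q" "x \<in> A i" "y \<in> A j" by blast
    have "i \<noteq> j"
    proof
      assume "i = j"
      then have "e \<subseteq> A i" "card e = 2" using ij xy by auto
      then have "e = A i" using A[OF ij(1)] by (simp add: nsets_def card_subset_eq)
      then show False using e ij(1) by blast
    qed
    then show "e \<in> E" using edge[of i j x y] ij xy(1) by simp
  qed
  ultimately show ?thesis
    unfolding has_cocktail_party_def by (intro exI[of _ "A ` {..<q}"]) simp
qed

text \<open>Every vertex of \<open>W\<close> selects a \<open>t\<close>-subset of its neighbours in each of the \<open>q\<close> classes. There
  are \<open>(T choose t) ^ q\<close> selections, so by the pigeonhole principle some \<open>t\<close> vertices select the
  same subsets.\<close>
lemma common_neighbourhoods:
  fixes E :: "'a set set"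
  assumes W: "finite W" and A: "\<And>i. i < q \<Longrightarrow> finite (A i) \<and> card (A i) = T" and "t \<le> T"
    and deg: "\<And>v i. v \<in> W \<Longrightarrow> i < q \<Longrightarrow> t \<le> card {u \<in> A i. {u, v} \<in> E}"
    and large: "t * (T choose t) ^ q \<le> card W"
  obtains B D where "D \<in> nsets W t" and "\<And>i. i < q \<Longrightarrow> B i \<in> nsets (A i) t"
    and "\<And>i u v. i < q \<Longrightarrow> u \<in> B i \<Longrightarrow> v \<in> D \<Longrightarrow> {u, v} \<in> E"
proof -
  let ?B = "PiE {..<q} (\<lambda>i. nsets (A i) t)"
  have "\<exists>g\<in>?B. \<forall>i<q. \<forall>u\<in>g i. {u, v} \<in> E" if v: "v \<in> W" for v
  proof -
    have "\<forall>i\<in>{..<q}. \<exists>S. S \<in> nsets (A i) t \<and> (\<forall>u\<in>S. {u, v} \<in> E)"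
    proof
      fix i assume "i \<in> {..<q}"
      then have "t \<le> card {u \<in> A i. {u, v} \<in> E}" using deg v by auto
      then obtain S where "S \<subseteq> {u \<in> A i. {u, v} \<in> E}" "card S = t" "finite S"
        by (rule obtain_subset_with_card_n)
      then show "\<exists>S. S \<in> nsets (A i) t \<and> (\<forall>u\<in>S. {u, v} \<in> E)" by (auto simp: nsets_def)
    qed
    then obtain g where g: "\<forall>i\<in>{..<q}. g i \<in> nsets (A i) t \<and> (\<forall>u\<in>g i. {u, v} \<in> E)"
      by (rule bchoice[THEN exE])
    then show ?thesis by (intro bexI[of _ "restrict g {..<q}"]) auto
  qed
  then obtain G where G: "\<And>v. v \<in> W \<Longrightarrow> G v \<in> ?B"
    "\<And>v i u. v \<in> W \<Longrightarrow> i < q \<Longrightarrow> u \<in> G v i \<Longrightarrow> {u, v} \<in> E" by metis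
  have finB: "finite ?B" using A by (auto intro!: finite_PiE finite_imp_finite_nsets)
  have "card ?B = (T choose t) ^ q" using A by (simp add: card_PiE)
  moreover have pos: "0 < (T choose t) ^ q" using \<open>t \<le> T\<close> by simp
  ultimately have cardB: "card ?B = (T choose t) ^ q" "?B \<noteq> {}" by auto
  have "G \<in> W \<rightarrow> ?B" using G(1) by (rule Pi_I)
  then have "\<exists>B\<in>?B. card W \<le> card (G -` {B} \<inter> W) * card ?B"
    by (rule pigeonhole_card[OF _ W finB cardB(2)])
  then obtain B where B: "B \<in> ?B" "card W \<le> card (G -` {B} \<inter> W) * card ?B" ..
  then have "t * (T choose t) ^ q \<le> card (G -` {B} \<inter> W) * (T choose t) ^ q"
    using large cardB(1) by (metis le_trans)
  then have "t \<le> card (G -` {B} \<inter> W)" using pos by (metis mult_le_cancel2)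
  then obtain D where D: "D \<subseteq> G -` {B} \<inter> W" "card D = t" "finite D"
    by (rule obtain_subset_with_card_n)
  show thesis
  proof (rule that)
    show "D \<in> nsets W t" using D by (auto simp: nsets_def)
    show "B i \<in> nsets (A i) t" if "i < q" for i using B(1) that by (auto simp: PiE_def)
    show "{u, v} \<in> E" if "i < q" "u \<in> B i" "v \<in> D" for i u v
      using D(1) G(2)[of v i u] that by auto
  qed
qed

text \<open>Count the non-adjacent pairs between \<open>V\<close> and the classes. A vertex outside the set \<open>W\<close> in the
  conclusion misses at least \<open>T - t\<close> vertices of some class, which yields at least
  \<open>(card V - card W) * (T - t)\<close> pairs; the degree condition allows at most
  \<open>T * (1 - \<epsilon>) * card V\<close>. Since \<open>T - t \<ge> (1 - \<epsilon> / 2) * T\<close>, the slack of \<open>\<epsilon> / 2\<close> goes to \<open>W\<close>.\<close>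
lemma many_vertices_with_large_degree:
  fixes E :: "'a set set" and \<epsilon> :: real
  assumes V: "finite V" and A: "\<And>i. i < q \<Longrightarrow> A i \<in> nsets V T" and "0 < q" "0 < T"
    and t: "real t \<le> \<epsilon> / 2 * real T"
    and codeg: "\<And>v. v \<in> V \<Longrightarrow> real q * real (card {u \<in> V. {u, v} \<notin> E}) \<le> (1 - \<epsilon>) * real (card V)"
  shows "\<epsilon> / 2 * real (card V) \<le> real (card {v \<in> V. \<forall>i<q. t \<le> card {u \<in> A i. {u, v} \<in> E}})"
    (is "_ \<le> real (card ?W)")
proof -
  let ?n = "real (card V)" and ?w = "real (card ?W)"
  have AV: "A i \<subseteq> V" "finite (A i)" "card (A i) = T" if "i < q" for i
    using A[OF that] by (auto simp: nsets_def)
  have w: "real (card (V - ?W)) = ?n - ?w" "?w \<le> ?n"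
    using V by (auto simp: card_Diff_subset of_nat_diff card_mono)
  have miss: "real T - real t \<le> (\<Sum>i<q. real (card {u \<in> A i. {u, v} \<notin> E}))" if "v \<in> V - ?W" for v
  proof -
    have "\<exists>i<q. card {u \<in> A i. {u, v} \<in> E} < t" using that by (auto simp: not_le)
    then obtain i where i: "i < q" "card {u \<in> A i. {u, v} \<in> E} < t" by blast
    have "card ({u \<in> A i. {u, v} \<in> E} \<union> {u \<in> A i. {u, v} \<notin> E})
        \<le> card {u \<in> A i. {u, v} \<in> E} + card {u \<in> A i. {u, v} \<notin> E}"
      by (rule card_Un_le)
    also have "{u \<in> A i. {u, v} \<in> E} \<union> {u \<in> A i. {u, v} \<notin> E} = A i" by blast
    finally have "T \<le> card {u \<in> A i. {u, v} \<in> E} + card {u \<in> A i. {u, v} \<notin> E}"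
      using AV(3)[OF i(1)] by simp
    then have "real T - real t \<le> real (card {u \<in> A i. {u, v} \<notin> E})" using i by linarith
    also have "\<dots> \<le> (\<Sum>i<q. real (card {u \<in> A i. {u, v} \<notin> E}))"
      using i(1) by (intro member_le_sum) auto
    finally show ?thesis .
  qed
  have count: "real (card {x \<in> X. P x}) = (\<Sum>x\<in>X. of_bool (P x))" if "finite X" for X :: "'a set" and P
    using that by (simp add: sum_of_bool_eq Int_def)
  have "(?n - ?w) * (real T - real t) \<le> (\<Sum>v\<in>V - ?W. \<Sum>i<q. real (card {u \<in> A i. {u, v} \<notin> E}))"
    using sum_bounded_below[of "V - ?W", OF miss] w(1) by simp
  also have "\<dots> \<le> (\<Sum>v\<in>V. \<Sum>i<q. real (card {u \<in> A i. {u, v} \<notin> E}))"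
    using V by (intro sum_mono2) (auto intro: sum_nonneg)
  also have "\<dots> = (\<Sum>i<q. \<Sum>v\<in>V. \<Sum>u\<in>A i. of_bool ({u, v} \<notin> E))"
    using AV by (subst sum.swap) (intro sum.cong refl count, auto)
  also have "\<dots> = (\<Sum>i<q. \<Sum>u\<in>A i. \<Sum>v\<in>V. of_bool ({u, v} \<notin> E))"
    by (intro sum.cong refl sum.swap)
  also have "\<dots> = (\<Sum>i<q. \<Sum>u\<in>A i. real (card {v \<in> V. {v, u} \<notin> E}))"
    unfolding count[OF V] by (simp only: insert_commute)
  finally have "real q * ((?n - ?w) * (real T - real t)) \<le>
      (\<Sum>i<q. \<Sum>u\<in>A i. real q * real (card {v \<in> V. {v, u} \<notin> E}))"
    by (simp add: mult_left_mono flip: sum_distrib_left)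
  also have "\<dots> \<le> (\<Sum>i<q. \<Sum>u\<in>A i. (1 - \<epsilon>) * ?n)"
    using AV codeg by (intro sum_mono) blast
  also have "\<dots> = real q * (real T * ((1 - \<epsilon>) * ?n))"
    using AV by simp
  finally have "(?n - ?w) * (real T - real t) \<le> real T * ((1 - \<epsilon>) * ?n)"
    using \<open>0 < q\<close> by simp
  moreover have "(?n - ?w) * ((1 - \<epsilon> / 2) * real T) \<le> (?n - ?w) * (real T - real t)"
    using w(2) t by (intro mult_left_mono) (auto simp: algebra_simps)
  ultimately have "real T * ((?n - ?w) * (1 - \<epsilon> / 2)) \<le> real T * ((1 - \<epsilon>) * ?n)"
    by (simp add: algebra_simps)
  then have "(?n - ?w) * (1 - \<epsilon> / 2) \<le> (1 - \<epsilon>) * ?n"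
    using \<open>0 < T\<close> by simp
  moreover have "0 \<le> \<epsilon> * ?w"
    using t \<open>0 < T\<close> by (smt (verit) mult_nonneg_nonneg of_nat_0_le_iff of_nat_0_less_iff
        zero_less_mult_pos2 mult_neg_pos field_sum_of_halves)
  ultimately show ?thesis by (simp add: algebra_simps)
qed

text \<open>The degree condition is expressed by non-neighbours (in a graph without loops each vertex
  is one of its own) and multiplied by \<open>r\<close>. In this form it makes sense in the base case
  \<open>r = 0\<close>, and it becomes weaker as \<open>r\<close> decreases, so that the induction hypothesis applies
  to the same graph. The induction step starts from much larger classes, of size \<open>T\<close>, and
  shrinks them to size \<open>t\<close> in order to gain one further class of common neighbours.\<close>
lemma erdos_stone_codegree:
  fixes \<epsilon> :: real
  assumes \<epsilon>: "0 < \<epsilon>"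
  shows "\<exists>N. \<forall>(V :: 'a set) E. finite V \<longrightarrow> N \<le> card V \<longrightarrow>
    (\<forall>v\<in>V. real r * real (card {u \<in> V. {u, v} \<notin> E}) \<le> (1 - \<epsilon>) * real (card V)) \<longrightarrow>
    has_complete_multipartite V E (Suc r) t"
proof (induction r arbitrary: t)
  case 0
  have "has_complete_multipartite V E (Suc 0) t" if "t \<le> card V" for V :: "'a set" and E
  proof -
    from that obtain S where "S \<subseteq> V" "card S = t" "finite S"
      by (rule obtain_subset_with_card_n)
    then show ?thesis
      unfolding has_complete_multipartite_def by (intro exI[of _ "\<lambda>_. S"]) (auto simp: nsets_def)
  qed
  then show ?case by blast
next
  case (Suc r)
  let ?q = "Suc r"
  obtain T0 where T0: "2 * real t / \<epsilon> < real T0" using reals_Archimedean2 by blast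
  define T where "T = Suc (max t T0)"
  have T: "0 < T" "t \<le> T" "real t \<le> \<epsilon> / 2 * real T"
  proof -
    have "2 * real t / \<epsilon> < real T" using T0 by (simp add: T_def)
    then show "real t \<le> \<epsilon> / 2 * real T" using \<epsilon> by (simp add: field_simps)
  qed (auto simp: T_def)
  obtain N1 where N1: "\<And>(V :: 'a set) E. finite V \<Longrightarrow> N1 \<le> card V \<Longrightarrow>
      (\<forall>v\<in>V. real r * real (card {u \<in> V. {u, v} \<notin> E}) \<le> (1 - \<epsilon>) * real (card V)) \<Longrightarrow>
      has_complete_multipartite V E (Suc r) T"
    using Suc.IH[of T] by blast
  \<comment> \<open>the number of vertices that the pigeonhole argument needs\<close>
  define m where "m = t * (T choose t) ^ ?q"
  obtain N2 where N2: "2 * real m / \<epsilon> < real N2" using reals_Archimedean2 by blast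
  have "has_complete_multipartite V E (Suc ?q) t"
    if V: "finite V" and N: "max N1 N2 \<le> card V"
      and codeg: "\<forall>v\<in>V. real ?q * real (card {u \<in> V. {u, v} \<notin> E}) \<le> (1 - \<epsilon>) * real (card V)"
    for V :: "'a set" and E
  proof -
    have "\<forall>v\<in>V. real r * real (card {u \<in> V. {u, v} \<notin> E}) \<le> (1 - \<epsilon>) * real (card V)"
    proof
      fix v assume "v \<in> V"
      have "real r * real (card {u \<in> V. {u, v} \<notin> E}) \<le> real ?q * real (card {u \<in> V. {u, v} \<notin> E})"
        by (intro mult_right_mono) auto
      then show "real r * real (card {u \<in> V. {u, v} \<notin> E}) \<le> (1 - \<epsilon>) * real (card V)"
        using codeg \<open>v \<in> V\<close> by force
    qed
    then have "has_complete_multipartite V E ?q T" using N1 V N by simp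
    then obtain A where "\<forall>i<?q. A i \<in> nsets V T"
      and "\<forall>i<?q. \<forall>j<i. \<forall>x\<in>A i. \<forall>y\<in>A j. {x, y} \<in> E"
      unfolding has_complete_multipartite_def by (elim exE conjE)
    note A = this(1)[rule_format] and AE = this(2)[rule_format]
    define W where "W = {v \<in> V. \<forall>i<?q. t \<le> card {u \<in> A i. {u, v} \<in> E}}"
    have "\<epsilon> / 2 * real (card V) \<le> real (card W)"
      unfolding W_def using codeg by (intro many_vertices_with_large_degree[OF V A _ T(1,3)]) auto
    moreover have "2 * real m / \<epsilon> \<le> real (card V)" using N N2 by linarith
    then have "real m \<le> \<epsilon> / 2 * real (card V)" using \<epsilon> by (simp add: field_simps)
    ultimately have "m \<le> card W" by linarith
    moreover have "finite W" using V by (simp add: W_def)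
    ultimately obtain B D where BD: "D \<in> nsets W t" "\<And>i. i < ?q \<Longrightarrow> B i \<in> nsets (A i) t"
      "\<And>i u v. i < ?q \<Longrightarrow> u \<in> B i \<Longrightarrow> v \<in> D \<Longrightarrow> {u, v} \<in> E"
      using A T(2) by (elim common_neighbourhoods[of W ?q A T t E]) (auto simp: m_def W_def nsets_def)
    show ?thesis
      unfolding has_complete_multipartite_def
    proof (intro exI[of _ "B(?q := D)"] conjI allI impI ballI)
      fix i assume "i < Suc ?q"
      then show "(B(?q := D)) i \<in> nsets V t"
        using BD(1) BD(2)[of i] A[of i] by (cases "i = ?q") (auto simp: nsets_def W_def)
    next
      fix i j x y
      assume ij: "i < Suc ?q" "j < i" and x: "x \<in> (B(?q := D)) i" and y: "y \<in> (B(?q := D)) j"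
      show "{x, y} \<in> E"
      proof (cases "i = ?q")
        case True
        then have "{y, x} \<in> E" using BD(3)[of j y x] ij x y by simp
        then show ?thesis by (simp add: insert_commute)
      next
        case False
        then have "x \<in> A i" "y \<in> A j" using BD(2)[of i] BD(2)[of j] ij x y by (auto simp: nsets_def)
        then show ?thesis using AE[of i j x y] ij False by simp
      qed
    qed
  qed
  then show ?case by blast
qed

text \<open>A graph without the complete multipartite graph and with at least \<open>N\<close> vertices has a vertex
  whose degree is at most \<open>c = 1 - (1 - \<epsilon>) / r\<close> times the number of vertices. Deleting such vertices
  until fewer than \<open>N\<close> are left removes at most \<open>c * (1 + \<dots> + card V)\<close> edges, and at most \<open>N\<^sup>2\<close>
  edges remain.\<close>
lemma erdos_stone_edges:
  fixes \<epsilon> :: real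
  assumes \<epsilon>: "0 < \<epsilon>" and r: "0 < r"
  shows "\<exists>N. \<forall>(V :: 'a set) E. finite V \<longrightarrow> E \<subseteq> nsets V 2 \<longrightarrow>
    \<not> has_complete_multipartite V E (Suc r) t \<longrightarrow>
    real (card E) \<le> real N ^ 2 + (1 - (1 - \<epsilon>) / real r) * (real (card V) * (real (card V) + 1) / 2)"
proof -
  define c where "c = 1 - (1 - \<epsilon>) / real r"
  have c: "0 \<le> c" using \<epsilon> r by (simp add: c_def field_simps)
  obtain N where N: "\<And>(V :: 'a set) E. finite V \<Longrightarrow> N \<le> card V \<Longrightarrow>
      (\<forall>v\<in>V. real r * real (card {u \<in> V. {u, v} \<notin> E}) \<le> (1 - \<epsilon>) * real (card V)) \<Longrightarrow>
      has_complete_multipartite V E (Suc r) t"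
    using erdos_stone_codegree[OF \<epsilon>, of r t] by blast
  have "real (card E) \<le> real N ^ 2 + c * (real n * (real n + 1) / 2)"
    if "finite V" "card V = n" "E \<subseteq> nsets V 2" "\<not> has_complete_multipartite V E (Suc r) t"
    for n and V :: "'a set" and E
    using that
  proof (induction n arbitrary: V E)
    case 0
    then have "E = {}" by (auto simp: nsets_def)
    then show ?case by simp
  next
    case (Suc n)
    note V = Suc.prems(1,2) and E = Suc.prems(3) and free = Suc.prems(4)
    show ?case
    proof (cases "N \<le> card V")
      case False
      have "card E \<le> card (nsets V 2)"
        using E V(1) by (intro card_mono finite_imp_finite_nsets)
      also have "\<dots> \<le> card V * card V" by (simp add: choose_two) (metis diff_le_self div_le_dividend le_trans mult_le_mono2)
      also have "\<dots> \<le> N * N" using False by (intro mult_le_mono) auto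
      finally have "real (card E) \<le> real N ^ 2"
        unfolding power2_eq_square by (metis of_nat_le_iff of_nat_mult)
      moreover have "0 \<le> c * (real (Suc n) * (real (Suc n) + 1) / 2)" using c by simp
      ultimately show ?thesis by linarith
    next
      case True
      then obtain v where v: "v \<in> V"
        and codeg: "(1 - \<epsilon>) * real (card V) < real r * real (card {u \<in> V. {u, v} \<notin> E})"
        using N[OF V(1) True, of E] free by force
      define E' where "E' = {e \<in> E. v \<notin> e}"
      have finE: "finite E" using E V(1) finite_imp_finite_nsets finite_subset by blast
      have "\<not> has_complete_multipartite (V - {v}) E' (Suc r) t"
        using free has_complete_multipartite_mono[of "V - {v}" E' "Suc r" t V E]
        by (auto simp: E'_def)
      moreover have "E' \<subseteq> nsets (V - {v}) 2" using E by (auto simp: E'_def nsets_def)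
      ultimately have IH: "real (card E') \<le> real N ^ 2 + c * (real n * (real n + 1) / 2)"
        using V v by (intro Suc.IH[of "V - {v}"]) auto
      have "{e \<in> E. v \<in> e} \<subseteq> (\<lambda>u. {u, v}) ` {u \<in> V. {u, v} \<in> E}"
      proof
        fix e assume e: "e \<in> {e \<in> E. v \<in> e}"
        then have "e \<in> nsets V 2" using E by blast
        then obtain x y where "e = {x, y}" "x \<in> V" "y \<in> V" "x \<noteq> y" by (rule nsets2_E)
        then have "\<exists>u\<in>V. e = {u, v}" using e by auto
        then show "e \<in> (\<lambda>u. {u, v}) ` {u \<in> V. {u, v} \<in> E}" using e by blast
      qed
      then have "card {e \<in> E. v \<in> e} \<le> card {u \<in> V. {u, v} \<in> E}"
        using V(1) by (intro surj_card_le) auto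
      moreover have "card V = card {u \<in> V. {u, v} \<in> E} + card {u \<in> V. {u, v} \<notin> E}"
        using V(1) by (subst card_Un_disjoint[symmetric]) (auto intro: arg_cong[of _ _ card])
      moreover have "(1 - \<epsilon>) / real r * real (card V) \<le> real (card {u \<in> V. {u, v} \<notin> E})"
        using codeg r by (simp add: field_simps)
      ultimately have deg: "real (card {e \<in> E. v \<in> e}) \<le> c * real (card V)"
        unfolding c_def left_diff_distrib by linarith
      have "card E = card E' + card {e \<in> E. v \<in> e}"
        unfolding E'_def using finE
        by (subst card_Un_disjoint[symmetric]) (auto intro: arg_cong[of _ _ card])
      then have "real (card E) \<le> real N ^ 2 + c * (real n * (real n + 1) / 2) + c * real (Suc n)"
        using IH deg V(2) by simp
      also have "\<dots> = real N ^ 2 + c * (real (Suc n) * (real (Suc n) + 1) / 2)"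
        by (simp add: field_simps)
      finally show ?thesis .
    qed
  qed
  then show ?thesis unfolding c_def by blast
qed

section \<open>The balanced complete multipartite graph\<close>

definition turan_graph_edges :: "nat \<Rightarrow> nat \<Rightarrow> nat set set" where
  "turan_graph_edges n r = {e \<in> nsets {..<n} 2. inj_on (\<lambda>x. x mod r) e}"

text \<open>These are the numbers \<open>j - r, j - 2 * r, \<dots>\<close> that are not negative.\<close>
lemma card_same_residue_below:
  assumes "0 < r"
  shows "card {i. i < j \<and> i mod r = j mod r} \<le> j div r"
proof -
  have "{i. i < j \<and> i mod r = j mod r} \<subseteq> (\<lambda>k. j - r * Suc k) ` {..<j div r}"
  proof
    fix i assume "i \<in> {i. i < j \<and> i mod r = j mod r}"
    then have i: "i < j" "i mod r = j mod r" by auto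
    then have "r dvd j - i" using mod_eq_dvd_iff_nat[of i j r] by simp
    then obtain m where m: "j - i = r * m" by (rule dvdE)
    then obtain k where k: "m = Suc k" using i(1) by (cases m) auto
    have "m * r \<le> j" using m by (metis diff_le_self mult.commute)
    then have "m \<le> j div r" using assms by (simp add: less_eq_div_iff_mult_less_eq)
    moreover have "i = j - r * Suc k"
      using i(1) unfolding k[symmetric] m[symmetric] by simp
    ultimately show "i \<in> (\<lambda>k. j - r * Suc k) ` {..<j div r}" using k by auto
  qed
  then show ?thesis using surj_card_le[of "{..<j div r}"] by simp
qed

lemma card_nonedges_turan_graph:
  assumes "0 < r"
  shows "real (card (nsets {..<n} 2 - turan_graph_edges n r)) \<le> (real n)\<^sup>2 / (2 * real r)"
proof -
  let ?S = "\<lambda>j. {i. i < j \<and> i mod r = j mod r}"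
  have "nsets {..<n} 2 - turan_graph_edges n r \<subseteq> (\<Union>j<n. (\<lambda>i. {i, j}) ` ?S j)"
  proof
    fix e assume e: "e \<in> nsets {..<n} 2 - turan_graph_edges n r"
    then have "e \<in> nsets {..<n} 2" by blast
    then obtain x y where xy: "e = {x, y}" "x < n" "y < n" "x \<noteq> y" by (auto elim: nsets2_E)
    then have "x mod r = y mod r" using e by (auto simp: turan_graph_edges_def)
    then obtain i j where "e = {i, j}" "i < j" "j < n" "i mod r = j mod r"
      using xy by (metis insert_commute linorder_neqE_nat)
    then show "e \<in> (\<Union>j<n. (\<lambda>i. {i, j}) ` ?S j)" by (intro UN_I[of j]) auto
  qed
  then have "card (nsets {..<n} 2 - turan_graph_edges n r) \<le> card (\<Union>j<n. (\<lambda>i. {i, j}) ` ?S j)"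
    by (rule card_mono[rotated]) (intro finite_UN_I finite_imageI finite_lessThan, simp)
  also have "\<dots> \<le> (\<Sum>j<n. card ((\<lambda>i. {i, j}) ` ?S j))" by (rule card_UN_le) simp
  also have "\<dots> \<le> (\<Sum>j<n. j div r)"
    using card_same_residue_below[OF assms] by (intro sum_mono order_trans[OF card_image_le]) auto
  finally have "real (card (nsets {..<n} 2 - turan_graph_edges n r)) \<le> (\<Sum>j<n. real (j div r))"
    by (metis of_nat_le_iff of_nat_sum)
  also have "\<dots> \<le> (\<Sum>j<n. real j / real r)"
    by (intro sum_mono) (simp add: of_nat_div_le_of_nat)
  also have "\<dots> = (\<Sum>j<n. real j) / real r" by (simp add: sum_divide_distrib)
  also have "(\<Sum>j<n. real j) = real n * (real n - 1) / 2" by (induction n) (auto simp: field_simps)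
  also have "real n * (real n - 1) / 2 / real r \<le> (real n)\<^sup>2 / (2 * real r)"
    using assms by (simp add: power2_eq_square field_simps)
  finally show ?thesis .
qed

section \<open>The crossing number\<close>

theorem proposition20:
  fixes s :: nat
  assumes "s \<ge> 2"
  shows "(\<forall>n>s. int (crossing_number n (n - s) (n - 2)) =
            int (n choose 2)
              - int (turan_number n {complete_graph (s + 1), complete_minus_matching s})) \<and>
         (\<lambda>n. real (crossing_number n (n - s) (n - 2)) - 1 / (2 * real s - 2) * (real n)\<^sup>2)
            \<in> o(\<lambda>n. (real n)\<^sup>2)"
proof
  show "\<forall>n>s. int (crossing_number n (n - s) (n - 2)) =
            int (n choose 2)
              - int (turan_number n {complete_graph (s + 1), complete_minus_matching s})"
  proof (intro allI impI)
    fix n assume "s < n"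
    obtain E :: "nat set set" where "turan_number n {complete_graph (s + 1), complete_minus_matching s} = card E"
      "crossing_number n (n - s) (n - 2) + card E = n choose 2"
      by (rule crossing_number_turan[OF assms \<open>s < n\<close>]) (rule that)
    then show "int (crossing_number n (n - s) (n - 2)) = int (n choose 2)
        - int (turan_number n {complete_graph (s + 1), complete_minus_matching s})"
      by linarith
  qed
next
  define r where "r = s - 1"
  have r: "0 < r" "s = Suc r" "2 * real s - 2 = 2 * real r" using assms by (auto simp: r_def)
  let ?f = "\<lambda>n. real (crossing_number n (n - s) (n - 2))"
  show "(\<lambda>n. ?f n - 1 / (2 * real s - 2) * (real n)\<^sup>2) \<in> o(\<lambda>n. (real n)\<^sup>2)"
  proof (rule landau_o.smallI)
    fix \<epsilon> :: real assume \<epsilon>: "0 < \<epsilon>"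
    obtain N where N: "\<And>(V :: nat set) E. finite V \<Longrightarrow> E \<subseteq> nsets V 2 \<Longrightarrow>
        \<not> has_complete_multipartite V E (Suc r) 2 \<Longrightarrow>
        real (card E) \<le> real N ^ 2 + (1 - (1 - \<epsilon>) / real r) * (real (card V) * (real (card V) + 1) / 2)"
      using erdos_stone_edges[OF \<epsilon> r(1), of 2] by metis
    \<comment> \<open>With \<open>\<epsilon>\<close> in the role of the Erdos-Stone slack, the leading error term is
      \<open>\<epsilon> n\<^sup>2 / (2 r)\<close>, at most half of the permitted \<open>\<epsilon> n\<^sup>2\<close>; the rest grows linearly in \<open>n\<close>.\<close>
    have error: "\<bar>?f n - (real n)\<^sup>2 / (2 * real r)\<bar> \<le>
        \<epsilon> / (2 * real r) * ((real n)\<^sup>2 + real n) + (real n + (real N)\<^sup>2)" if n: "s < n" for n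
    proof -
      obtain E where E: "clique_cocktail_free n s E"
        and max: "\<And>E'. clique_cocktail_free n s E' \<Longrightarrow> card E' \<le> card E"
        and f: "crossing_number n (n - s) (n - 2) + card E = n choose 2"
        using crossing_number_turan[OF assms n] by metis
      have choose: "real (n choose 2) = real n * (real n - 1) / 2"
        using n by (simp add: choose_two real_of_nat_div of_nat_diff)
      have "\<not> has_complete_multipartite {..<n} E s 2" "E \<subseteq> nsets {..<n} 2"
        using E has_cocktail_party_if_multipartite[of E "{..<n}" s]
        by (auto simp: clique_cocktail_free_def)
      then have "real (card E) \<le> (real N)\<^sup>2 + (1 - (1 - \<epsilon>) / real r) * (real n * (real n + 1) / 2)"
        using N[of "{..<n}" E] by (simp add: r(2))
      moreover have "?f n = real n * (real n - 1) / 2 - real (card E)"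
        using f choose by (metis add_diff_cancel_right' of_nat_add)
      moreover have "(1 - (1 - \<epsilon>) / real r) * (real n * (real n + 1) / 2)
          = real n * (real n + 1) / 2 - (real n)\<^sup>2 / (2 * real r) - real n / (2 * real r)
            + \<epsilon> / (2 * real r) * ((real n)\<^sup>2 + real n)"
        using r(1) by (simp add: field_simps power2_eq_square)
      moreover have "real n * (real n + 1) / 2 = real n * (real n - 1) / 2 + real n"
        by (simp add: field_simps)
      moreover have "0 \<le> real n / (2 * real r)" by simp
      ultimately have lower: "(real n)\<^sup>2 / (2 * real r)
          - (\<epsilon> / (2 * real r) * ((real n)\<^sup>2 + real n) + (real n + (real N)\<^sup>2)) \<le> ?f n"
        by linarith
      let ?T = "turan_graph_edges n r"
      have T: "?T \<subseteq> nsets {..<n} 2" by (auto simp: turan_graph_edges_def)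
      have "clique_cocktail_free n s ?T"
        using T r by (intro clique_cocktail_free_if_colourable[of _ _ "\<lambda>x. x mod r" r])
          (auto simp: turan_graph_edges_def inj_on_def)
      then have "card ?T \<le> card E" by (rule max)
      moreover have "card (nsets {..<n} 2 - ?T) = (n choose 2) - card ?T"
        using T by (simp add: card_Diff_subset finite_imp_finite_nsets finite_subset)
      ultimately have "crossing_number n (n - s) (n - 2) \<le> card (nsets {..<n} 2 - ?T)"
        using f by linarith
      then have upper: "?f n \<le> (real n)\<^sup>2 / (2 * real r)"
        using card_nonedges_turan_graph[OF r(1), of n] by linarith
      have "0 \<le> \<epsilon> / (2 * real r) * ((real n)\<^sup>2 + real n) + (real n + (real N)\<^sup>2)"
        using \<epsilon> by simp
      then show ?thesis using lower upper by linarith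
    qed
    have "eventually (\<lambda>n. real n + (real n + (real N)\<^sup>2) / \<epsilon> \<le> (real n)\<^sup>2 / 2) at_top"
      using \<epsilon> by real_asymp
    then show "eventually (\<lambda>n. norm (?f n - 1 / (2 * real s - 2) * (real n)\<^sup>2)
        \<le> \<epsilon> * norm ((real n)\<^sup>2)) at_top"
      using eventually_gt_at_top[of s]
    proof eventually_elim
      case (elim n)
      have "\<epsilon> / (2 * real r) * ((real n)\<^sup>2 + real n) \<le> \<epsilon> / 2 * ((real n)\<^sup>2 + real n)"
        using \<epsilon> r(1) by (intro mult_right_mono divide_left_mono) auto
      moreover have "\<epsilon> * (real n + (real n + (real N)\<^sup>2) / \<epsilon>) \<le> \<epsilon> * ((real n)\<^sup>2 / 2)"
        using elim(1) \<epsilon> by (intro mult_left_mono) auto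
      then have "\<epsilon> * real n + (real n + (real N)\<^sup>2) \<le> \<epsilon> * (real n)\<^sup>2 / 2"
        using \<epsilon> unfolding distrib_left by simp
      moreover have "0 \<le> \<epsilon> * real n" using \<epsilon> by simp
      ultimately have "\<bar>?f n - (real n)\<^sup>2 / (2 * real r)\<bar> \<le> \<epsilon> * (real n)\<^sup>2"
        using error[OF elim(2)] by (simp add: algebra_simps)
      then show ?case unfolding r(3) by simp
    qed
  qed
qed

end
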